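(* The satisfiability problem for $\mathsf{LHS}$ (over models with a single binary relation) is undecidable. That is, there is no algorithm which, given a formula $\varphi\in\mathcal{L}$, decides whether there exist a model $\mathfrak{M}=(W,R,V)$ and states $s,t\in W$ such that $\mathfrak{M},s,t\models\varphi$.
   Context: Let $\mathsf{L}=\{p^l_i: i\in\mathbb{N}\}$ and $\mathsf{R}=\{p^r_i: i\in\mathbb{N}\}$ be two disjoint countable sets of propositional variables. The language $\mathcal{L}$ of $\mathsf{LHS}$ is given by $\varphi ::= p^l \mid p^r \mid I \mid \neg\varphi \mid \varphi\wedge\varphi \mid \Box\varphi \mid \blacksquare\varphi$, where $p^l\in\mathsf{L}$, $p^r\in\mathsf{R}$ and $I$ is a constant. A model is $\mathfrak{M}=(W,R,V)$ with $W$ a non-empty set, $R\subseteq W\times W$, and $V:\mathsf{L}\cup\mathsf{R}\to\mathcal{P}(W)$. Write $R(w)=\{v: Rwv\}$. Formulas are evaluated at pairs of states $s,t\in W$: - $\mathfrak{M},s,t\models p^l$ iff $s\in V(p^l)$; - $\mathfrak{M},s,t\models p^r$ iff $t\in V(p^r)$; - $\mathfrak{M},s,t\models I$ iff $s=t$; - $\neg,\wedge$ are as usual; - $\mathfrak{M},s,t\models\Box\varphi$ iff $\mathfrak{M},s',t\models\varphi$ for all $s'\in R(s)$; - $\mathfrak{M},s,t\models\blacksquare\varphi$ iff $\mathfrak{M},s,t'\models\varphi$ for all $t'\in R(t)$. *)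

theory Defs
  imports Main "HOL-Library.Countable_Set" "HOL-Library.Nat_Bijection"
begin

section \<open>Syntax and semantics of LHS\<close>

text \<open>The two disjoint countable sets of propositional variables are the ranges of
  \<open>L\<close> and \<open>R\<close>.\<close>

datatype pvar = L nat | R nat

datatype form =
    Var pvar
  | Same
  | Neg form
  | Conj form form
  | Box form
  | BlackBox form

record 'w model =
  states :: "'w set"
  rel :: "('w \<times> 'w) set"
  val :: "pvar \<Rightarrow> 'w set"

definition is_model :: "'w model \<Rightarrow> bool" where
  "is_model M \<longleftrightarrow> states M \<noteq> {} \<and> rel M \<subseteq> states M \<times> states M \<and> (\<forall>p. val M p \<subseteq> states M)"

primrec eval_var :: "'w model \<Rightarrow> 'w \<Rightarrow> 'w \<Rightarrow> pvar \<Rightarrow> bool" where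
  "eval_var M s t (L i) \<longleftrightarrow> s \<in> val M (L i)"
| "eval_var M s t (R i) \<longleftrightarrow> t \<in> val M (R i)"

primrec holds :: "'w model \<Rightarrow> 'w \<Rightarrow> 'w \<Rightarrow> form \<Rightarrow> bool" where
  "holds M s t (Var p) \<longleftrightarrow> eval_var M s t p"
| "holds M s t Same \<longleftrightarrow> s = t"
| "holds M s t (Neg \<phi>) \<longleftrightarrow> \<not> holds M s t \<phi>"
| "holds M s t (Conj \<phi> \<psi>) \<longleftrightarrow> holds M s t \<phi> \<and> holds M s t \<psi>"
| "holds M s t (Box \<phi>) \<longleftrightarrow> (\<forall>s' \<in> rel M `` {s}. holds M s' t \<phi>)"
| "holds M s t (BlackBox \<phi>) \<longleftrightarrow> (\<forall>t' \<in> rel M `` {t}. holds M s t' \<phi>)"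

text \<open>HOL cannot quantify over types inside a formula, so satisfiability refers to models
  whose states are drawn from a given type \<open>'w\<close>; the set of states is an arbitrary non-empty
  subset of that type. By \<open>satisfiable_transfer\<close> below, the choice of \<open>'w\<close> is immaterial as
  long as it is infinite: a formula that is satisfiable in any model whatsoever
  is satisfiable in one whose states are drawn from \<open>'w\<close>.\<close>

definition satisfiable :: "'w itself \<Rightarrow> form \<Rightarrow> bool" where
  "satisfiable (_ :: 'w itself) \<phi> \<longleftrightarrow>
     (\<exists>(M :: 'w model) s t. is_model M \<and> s \<in> states M \<and> t \<in> states M \<and> holds M s t \<phi>)"


section \<open>Algorithms: partial recursive functions\<close>

text \<open>Programs are untyped in the number of arguments; on argument lists of an unsuitable
  length they may simply have no value.\<close>

datatype recf =
    Zero
  | Succ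
  | Proj nat
  | Comp recf "recf list"
  | PrimRec recf recf
  | Mu recf

inductive computes :: "recf \<Rightarrow> nat list \<Rightarrow> nat \<Rightarrow> bool" where
  Zero: "computes Zero xs 0"
| Succ: "computes Succ [x] (Suc x)"
| Proj: "i < length xs \<Longrightarrow> computes (Proj i) xs (xs ! i)"
| Comp: "list_all2 (\<lambda>g z. computes g xs z) gs zs \<Longrightarrow> computes f zs y
    \<Longrightarrow> computes (Comp f gs) xs y"
| PrimRec_0: "computes f xs y \<Longrightarrow> computes (PrimRec f g) (0 # xs) y"
| PrimRec_Suc: "computes (PrimRec f g) (n # xs) y \<Longrightarrow> computes g (n # y # xs) z
    \<Longrightarrow> computes (PrimRec f g) (Suc n # xs) z"
| Mu: "computes f (n # xs) 0 \<Longrightarrow> (\<forall>i<n. \<exists>y. computes f (i # xs) (Suc y))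
    \<Longrightarrow> computes (Mu f) xs n"

text \<open>Formulas are presented to programs by a Goedel numbering.\<close>

primrec pvar_code :: "pvar \<Rightarrow> nat" where
  "pvar_code (L i) = prod_encode (0, i)"
| "pvar_code (R i) = prod_encode (1, i)"

primrec code :: "form \<Rightarrow> nat" where
  "code (Var p) = prod_encode (0, pvar_code p)"
| "code Same = prod_encode (1, 0)"
| "code (Neg \<phi>) = prod_encode (2, code \<phi>)"
| "code (Conj \<phi> \<psi>) = prod_encode (3, prod_encode (code \<phi>, code \<psi>))"
| "code (Box \<phi>) = prod_encode (4, code \<phi>)"
| "code (BlackBox \<phi>) = prod_encode (5, code \<phi>)"

text \<open>The deciding program has to halt with the right answer on every formula; nothing is
  required of it on numbers that do not code formulas.\<close>

definition decidable :: "(form \<Rightarrow> bool) \<Rightarrow> bool" where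
  "decidable P \<longleftrightarrow> (\<exists>f. \<forall>\<phi>. computes f [code \<phi>] (if P \<phi> then 1 else 0))"


section \<open>Adequacy of the definitions\<close>

lemma inj_pvar_code: "inj pvar_code"
proof (rule injI)
  show "p = q" if "pvar_code p = pvar_code q" for p q
    using that by (cases p; cases q) auto
qed

lemma inj_code: "inj code"
proof (rule injI)
  show "\<phi> = \<psi>" if "code \<phi> = code \<psi>" for \<phi> \<psi>
    using that
  proof (induction \<phi> arbitrary: \<psi>)
    case (Var p)
    then show ?case by (cases \<psi>) (auto dest: injD[OF inj_pvar_code])
  next
    case Same
    then show ?case by (cases \<psi>) auto
  next
    case (Neg \<phi>)
    then show ?case by (cases \<psi>) auto
  next
    case (Conj \<phi>1 \<phi>2)
    then show ?case by (cases \<psi>) auto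
  next
    case (Box \<phi>)
    then show ?case by (cases \<psi>) auto
  next
    case (BlackBox \<phi>)
    then show ?case by (cases \<psi>) auto
  qed
qed

lemma computes_deterministic:
  assumes "computes f xs y" and "computes f xs z"
  shows "y = z"
  using assms
proof (induction arbitrary: z rule: computes.induct)
  case (Zero xs)
  from Zero.prems show ?case by (cases rule: computes.cases) auto
next
  case (Succ x)
  from Succ.prems show ?case by (cases rule: computes.cases) auto
next
  case (Proj i xs)
  from Proj.prems show ?case by (cases rule: computes.cases) auto
next
  case (Comp xs gs zs f y)
  from Comp.prems obtain zs' where
    zs': "list_all2 (\<lambda>g z. computes g xs z) gs zs'" "computes f zs' z"
    by (cases rule: computes.cases) auto
  have "zs = zs'"
  proof (rule nth_equalityI)
    show "length zs = length zs'"
      using Comp.IH(1) zs'(1) by (auto dest!: list_all2_lengthD)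
    show "zs ! i = zs' ! i" if "i < length zs" for i
      using Comp.IH(1) zs'(1) that by (auto simp: list_all2_conv_all_nth)
  qed
  then show ?case using Comp.IH(2) zs'(2) by simp
next
  case (PrimRec_0 f xs y g)
  from PrimRec_0.prems show ?case
    by (cases rule: computes.cases) (auto intro: PrimRec_0.IH)
next
  case (PrimRec_Suc f g n xs y z z')
  from PrimRec_Suc.prems obtain y' where
    "computes (PrimRec f g) (n # xs) y'" "computes g (n # y' # xs) z'"
    by (cases rule: computes.cases) auto
  then show ?case using PrimRec_Suc.IH by blast
next
  case (Mu f n xs m)
  from Mu.prems have "computes f (m # xs) 0 \<and> (\<forall>i<m. \<exists>y. computes f (i # xs) (Suc y))"
    by (cases rule: computes.cases) auto
  then have m: "computes f (m # xs) 0" "\<forall>i<m. \<exists>y. computes f (i # xs) (Suc y)"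
    by blast+
  show ?case
  proof (rule ccontr)
    assume "n \<noteq> m"
    then consider "n < m" | "m < n" by linarith
    then show False
    proof cases
      case 1
      then obtain y where "computes f (n # xs) (Suc y)" using m(2) by blast
      then show False using Mu.IH(1) by blast
    next
      case 2
      then obtain y where "\<forall>z. computes f (m # xs) z \<longrightarrow> Suc y = z" using Mu.IH(2) by blast
      then show False using m(1) by blast
    qed
  qed
qed

text \<open>Downward Loewenheim-Skolem: close \<open>{s, t}\<close> under witnesses for boxed formulas that fail,
  and move the resulting countable model into the type \<open>'w\<close>.\<close>

theorem satisfiable_transfer:
  assumes sat: "satisfiable TYPE('v) \<phi>" and inf: "infinite (UNIV :: 'w set)"
  shows "satisfiable TYPE('w) \<phi>"
proof -
  from sat obtain M :: "'v model" and s t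
    where M: "is_model M" and s: "s \<in> states M" and t: "t \<in> states M" and h: "holds M s t \<phi>"
    by (auto simp: satisfiable_def)
  define wl where
    "wl = (\<lambda>(\<psi>, x, y). SOME x'. (x, x') \<in> rel M \<and> \<not> holds M x' y \<psi>)"
  define wr where
    "wr = (\<lambda>(\<psi>, x, y). SOME y'. (y, y') \<in> rel M \<and> \<not> holds M x y' \<psi>)"
  define A where "A = rec_nat {s, t}
    (\<lambda>_ B. B \<union> wl ` (UNIV \<times> B \<times> B) \<union> wr ` (UNIV \<times> B \<times> B))"
  have A0: "A 0 = {s, t}"
    and AS: "A (Suc n) = A n \<union> wl ` (UNIV \<times> A n \<times> A n) \<union> wr ` (UNIV \<times> A n \<times> A n)" for n
    by (simp_all add: A_def)
  have cform: "countable (UNIV :: form set)"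
    using inj_code by (rule countableI)
  have "countable (A n)" for n
    by (induction n) (simp_all add: A0 AS cform)
  define C where "C = (\<Union>n. A n)"
  have cC: "countable C"
    using \<open>\<And>n. countable (A n)\<close> by (simp add: C_def)
  have stC: "s \<in> C" "t \<in> C"
    using A0 by (auto simp: C_def)
  have monoA: "A m \<subseteq> A n" if "m \<le> n" for m n
    using that by (rule lift_Suc_mono_le[of A, rotated]) (auto simp: AS)
  have common: "\<exists>n. x \<in> A n \<and> y \<in> A n" if xy: "x \<in> C" "y \<in> C" for x y
  proof -
    from xy obtain m n where "x \<in> A m" "y \<in> A n" by (auto simp: C_def)
    then have "x \<in> A (max m n)" "y \<in> A (max m n)"
      using monoA[of m "max m n"] monoA[of n "max m n"] by auto
    then show ?thesis by blast
  qed
  have closed: "wl (\<psi>, x, y) \<in> C" "wr (\<psi>, x, y) \<in> C" if xy: "x \<in> C" "y \<in> C" for \<psi> x y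
  proof -
    from common[OF xy] obtain n where "x \<in> A n" "y \<in> A n" by blast
    then have "wl (\<psi>, x, y) \<in> A (Suc n)" "wr (\<psi>, x, y) \<in> A (Suc n)"
      unfolding AS by blast+
    then show "wl (\<psi>, x, y) \<in> C" "wr (\<psi>, x, y) \<in> C"
      unfolding C_def by blast+
  qed
  from inf obtain e :: "nat \<Rightarrow> 'w" where e: "inj e"
    using infinite_countable_subset by blast
  define k where "k = e \<circ> to_nat_on C"
  have k: "inj_on k C"
    unfolding k_def using cC e by (auto intro: comp_inj_on inj_on_to_nat_on inj_on_subset)
  then have keq: "k x = k y \<longleftrightarrow> x = y" if "x \<in> C" "y \<in> C" for x y
    using that by (auto dest: inj_onD)
  define D where "D = C \<inter> states M"
  define N :: "'w model" where
    "N = \<lparr>states = k ` D, rel = {(k x, k y) | x y. x \<in> D \<and> y \<in> D \<and> (x, y) \<in> rel M},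
      val = (\<lambda>p. k ` (D \<inter> val M p))\<rparr>"
  have DC: "x \<in> C" if "x \<in> D" for x
    using that by (simp add: D_def)
  have relN: "(k x, v) \<in> rel N \<longleftrightarrow> (\<exists>y \<in> D. v = k y \<and> (x, y) \<in> rel M)" if "x \<in> D" for x v
    using that by (auto simp: N_def keq DC)
  have valN: "k x \<in> val N p \<longleftrightarrow> x \<in> val M p" if "x \<in> D" for x p
    using that by (auto simp: N_def keq DC)
  have relM: "y \<in> states M" if "(x, y) \<in> rel M" for x y
    using M that by (auto simp: is_model_def)
  have truth: "holds N (k x) (k y) \<psi> \<longleftrightarrow> holds M x y \<psi>" if "x \<in> D" "y \<in> D" for x y \<psi>
    using that
  proof (induction \<psi> arbitrary: x y)
    case (Var p)
    then show ?case by (cases p) (auto simp: valN)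
  next
    case Same
    then show ?case by (simp add: keq DC)
  next
    case (Box \<psi>)
    have "\<exists>x' \<in> D. (x, x') \<in> rel M \<and> \<not> holds M x' y \<psi>"
      if "\<exists>x'. (x, x') \<in> rel M \<and> \<not> holds M x' y \<psi>"
    proof -
      from someI_ex[OF that] have "(x, wl (\<psi>, x, y)) \<in> rel M \<and> \<not> holds M (wl (\<psi>, x, y)) y \<psi>"
        by (simp add: wl_def)
      moreover from this have "wl (\<psi>, x, y) \<in> D"
        using closed(1) Box.prems relM by (auto simp: D_def)
      ultimately show ?thesis by blast
    qed
    moreover have "holds N (k x) (k y) (Box \<psi>) \<longleftrightarrow>
        (\<forall>x' \<in> D. (x, x') \<in> rel M \<longrightarrow> holds M x' y \<psi>)"
    proof -
      have "rel N `` {k x} = k ` {x' \<in> D. (x, x') \<in> rel M}"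
        using relN[OF Box.prems(1)] by blast
      then show ?thesis using Box by simp blast
    qed
    ultimately show ?case by auto
  next
    case (BlackBox \<psi>)
    have "\<exists>y' \<in> D. (y, y') \<in> rel M \<and> \<not> holds M x y' \<psi>"
      if "\<exists>y'. (y, y') \<in> rel M \<and> \<not> holds M x y' \<psi>"
    proof -
      from someI_ex[OF that] have "(y, wr (\<psi>, x, y)) \<in> rel M \<and> \<not> holds M x (wr (\<psi>, x, y)) \<psi>"
        by (simp add: wr_def)
      moreover from this have "wr (\<psi>, x, y) \<in> D"
        using closed(2) BlackBox.prems relM by (auto simp: D_def)
      ultimately show ?thesis by blast
    qed
    moreover have "holds N (k x) (k y) (BlackBox \<psi>) \<longleftrightarrow>
        (\<forall>y' \<in> D. (y, y') \<in> rel M \<longrightarrow> holds M x y' \<psi>)"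
    proof -
      have "rel N `` {k y} = k ` {y' \<in> D. (y, y') \<in> rel M}"
        using relN[OF BlackBox.prems(2)] by blast
      then show ?thesis using BlackBox by simp blast
    qed
    ultimately show ?case by auto
  qed auto
  have "s \<in> D" "t \<in> D"
    using stC s t by (simp_all add: D_def)
  then have "k s \<in> states N" "k t \<in> states N" "holds N (k s) (k t) \<phi>"
    using h truth by (simp_all add: N_def)
  moreover have "is_model N"
    using \<open>s \<in> D\<close> by (auto simp: is_model_def N_def)
  ultimately show ?thesis unfolding satisfiable_def by blast
qed

corollary satisfiable_cong:
  assumes "infinite (UNIV :: 'v set)" and "infinite (UNIV :: 'w set)"
  shows "satisfiable TYPE('v) = satisfiable TYPE('w)"
proof (intro ext iffI)
  show "satisfiable TYPE('w) \<phi>" if "satisfiable TYPE('v) \<phi>" for \<phi>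
    using that assms(2) by (rule satisfiable_transfer)
  show "satisfiable TYPE('v) \<phi>" if "satisfiable TYPE('w) \<phi>" for \<phi>
    using that assms(1) by (rule satisfiable_transfer)
qed

end

theory Submission
  imports Defs "HOL-Library.Countable" "HOL-Library.Multiset"
begin

text \<open>Why satisfiability is undecidable. The rules that define \<open>computes\<close> say when one value
  follows from others, so for a fixed program they amount to finitely many Horn clauses about
  tuples of natural numbers. A value is computed iff these clauses force it in every
  interpretation (\<open>computes_iff_program_forces_Goal\<close>): one direction is an induction on
  derivations, the other holds because the true computations form one interpretation that
  satisfies the clauses.

  A Horn program over tuples can be expressed by a formula. Let states of a model stand for
  tuples, and let the relation, with labelled edge states between tuples, encode the unary
  functions ``increment component \<open>j\<close>'' and ``substitute into the terms \<open>ts\<close>''. Three abilities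
  of the logic are combined. A spy state that sees every state in use lets a formula quantify
  over all tuples. Starting with both coordinates at one state \<open>x\<close>, moving the left one along a
  path \<open>u\<close> and the right one along \<open>v\<close>, the constant \<open>Same\<close> says that the two paths end in the
  same state; so the laws by which increments commute and pass through substitutions become
  formulas. Finally, the premises and the conclusion of a clause are statements about single
  substitution steps from \<open>x\<close>. In any model of these axioms the states reached from an origin by
  increments behave as tuples, and their labels form an interpretation of the program
  (\<open>satisfying_interpretation\<close>); conversely the genuine tuples form a model
  (\<open>holds_axioms_form_tuple_model\<close>). Hence the axioms together with ``the goal fails at
  \<open>(1, n)\<close>'' are satisfiable iff the program does not return \<open>1\<close> on input \<open>n\<close>
  (\<open>satisfiable_iff_interpretation\<close>).

  The input only enters through the conjunct \<open>query n\<close>, whose code is primitive recursive in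
  \<open>n\<close>. So a program deciding satisfiability yields a program \<open>d\<close> that, given the code of a
  formula \<open>\<psi>\<close>, decides whether \<open>Conj (query (code \<psi>)) \<psi>\<close> is satisfiable. With \<open>\<psi>\<close> the axioms
  for \<open>d\<close> itself, that formula is satisfiable iff \<open>d\<close> does not answer that it is.\<close>

section \<open>Horn clauses over the natural numbers\<close>

datatype tm = Num nat | Reg nat nat

primrec tval :: "(nat \<Rightarrow> nat) \<Rightarrow> tm \<Rightarrow> nat" where
  "tval a (Num c) = c"
| "tval a (Reg j c) = a j + c"

text \<open>Padding tuples with zeros to functions on all of \<open>nat\<close> lets one function space serve all
  arities.\<close>

definition vec :: "nat list \<Rightarrow> nat \<Rightarrow> nat" where
  "vec xs = (\<lambda>i. if i < length xs then xs ! i else 0)"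

definition inst :: "(nat \<Rightarrow> nat) \<Rightarrow> tm list \<Rightarrow> nat \<Rightarrow> nat" where
  "inst a ts = vec (map (tval a) ts)"

text \<open>\<open>Run f n\<close> is meant to hold of \<open>(y, x\<^sub>1, \<dots>, x\<^sub>n)\<close> if \<open>f\<close> returns \<open>y\<close> on
  \<open>x\<^sub>1, \<dots>, x\<^sub>n\<close>, and \<open>Below f n\<close> of \<open>(m, x\<^sub>1, \<dots>, x\<^sub>n)\<close> if \<open>f\<close> returns a positive value on
  \<open>i, x\<^sub>1, \<dots>, x\<^sub>n\<close> for every \<open>i < m\<close>; the latter turns the bounded quantifier in the rule for
  minimisation into a recursion. \<open>Goal\<close> is a name that mentions no program, so that the formula
  asking for the goal can be built before the diagonal program is known.\<close>

datatype pred = Run recf nat | Below recf nat | Goal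

type_synonym atom = "pred \<times> tm list"
type_synonym clause = "atom list \<times> atom"

primrec true_in :: "(pred \<Rightarrow> (nat \<Rightarrow> nat) \<Rightarrow> bool) \<Rightarrow> clause \<Rightarrow> bool" where
  "true_in I (ps, c) \<longleftrightarrow>
    (\<forall>a. (\<forall>p \<in> set ps. I (fst p) (inst a (snd p))) \<longrightarrow> I (fst c) (inst a (snd c)))"

abbreviation satisfies :: "(pred \<Rightarrow> (nat \<Rightarrow> nat) \<Rightarrow> bool) \<Rightarrow> clause list \<Rightarrow> bool" where
  "satisfies I \<Gamma> \<equiv> \<forall>c \<in> set \<Gamma>. true_in I c"

declare true_in.simps [simp del]

lemma true_inI:
  assumes "\<And>a. \<forall>p \<in> set ps. I (fst p) (inst a (snd p)) \<Longrightarrow> I Q (inst a us)"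
  shows "true_in I (ps, Q, us)"
  using assms by (auto simp: true_in.simps)

lemma true_inD:
  assumes "true_in I (ps, Q, us)" and "\<forall>p \<in> set ps. I (fst p) (inst a (snd p))"
  shows "I Q (inst a us)"
  using assms by (auto simp: true_in.simps)

section \<open>The rules of computation as Horn clauses\<close>

definition regs :: "nat \<Rightarrow> nat \<Rightarrow> tm list" where
  "regs k n = map (\<lambda>i. Reg i 0) [k..<k + n]"

text \<open>One clause per rule of \<open>computes\<close> (two auxiliary ones for \<open>Mu\<close>), collected for all
  subprograms at the arities at which they are called. In each clause the variables are numbered
  in the order: parameters, recursion or search argument, intermediate values, result. Where no
  rule applies at arity \<open>n\<close>, there is no clause.\<close>

fun clauses :: "recf \<Rightarrow> nat \<Rightarrow> clause list" where
  "clauses Zero n = [([], Run Zero n, Num 0 # regs 0 n)]"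
| "clauses Succ n = (if n = 1 then [([], Run Succ 1, [Reg 0 1, Reg 0 0])] else [])"
| "clauses (Proj i) n = (if i < n then [([], Run (Proj i) n, Reg i 0 # regs 0 n)] else [])"
| "clauses (Comp f gs) n =
    (let m = length gs in
      ((Run f m, Reg (n + m) 0 # regs n m)
         # map (\<lambda>i. (Run (gs ! i) n, Reg (n + i) 0 # regs 0 n)) [0..<m],
       Run (Comp f gs) n, Reg (n + m) 0 # regs 0 n)
      # clauses f m @ concat (map (\<lambda>g. clauses g n) gs))"
| "clauses (PrimRec f g) n = (case n of 0 \<Rightarrow> [] | Suc k \<Rightarrow>
    ([(Run f k, Reg k 0 # regs 0 k)], Run (PrimRec f g) n, Reg k 0 # Num 0 # regs 0 k)
    # ([(Run (PrimRec f g) n, Reg (k + 1) 0 # Reg k 0 # regs 0 k),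
        (Run g (Suc n), Reg (k + 2) 0 # Reg k 0 # Reg (k + 1) 0 # regs 0 k)],
       Run (PrimRec f g) n, Reg (k + 2) 0 # Reg k 1 # regs 0 k)
    # clauses f k @ clauses g (Suc n))"
| "clauses (Mu f) n =
    ([], Below f n, Num 0 # regs 0 n)
    # ([(Below f n, Reg n 0 # regs 0 n),
        (Run f (Suc n), Reg (n + 1) 1 # Reg n 0 # regs 0 n)],
       Below f n, Reg n 1 # regs 0 n)
    # ([(Below f n, Reg n 0 # regs 0 n),
        (Run f (Suc n), Num 0 # Reg n 0 # regs 0 n)],
       Run (Mu f) n, Reg n 0 # regs 0 n)
    # clauses f (Suc n)"

lemma length_regs [simp]: "length (regs k n) = n"
  by (simp add: regs_def)

lemma tval_regs: "map (tval a) (regs k n) = map a [k..<k + n]"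
  by (simp add: regs_def)

lemma vec_append [simp]: "vec (xs @ ys) i = (if i < length xs then xs ! i else vec ys (i - length xs))"
  by (auto simp: vec_def nth_append)

lemma vec_Cons [simp]: "vec (x # xs) 0 = x" "vec (x # xs) (Suc i) = vec xs i"
  by (simp_all add: vec_def)

lemma map_vec_prefix [simp]: "map (vec (xs @ ys)) [0..<length xs] = xs"
  by (rule nth_equalityI) simp_all

lemma map_vec_middle [simp]:
  "map (vec (xs @ ys @ zs)) [length xs..<length xs + length ys] = ys"
  by (rule nth_equalityI) simp_all

text \<open>Each rule of \<open>computes\<close> is matched by an instance of a clause, whose assignment lists the
  values of the variables in the numbering of that clause.\<close>

lemma computes_forces:
  assumes "computes f xs y" and "satisfies I (clauses f (length xs))"
  shows "I (Run f (length xs)) (vec (y # xs))"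
  using assms
proof (induction rule: computes.induct)
  case (Zero xs)
  then show ?case
    using true_inD[of I "[]" "Run Zero (length xs)" "Num 0 # regs 0 (length xs)" "vec (xs @ [])"]
    by (simp add: inst_def tval_regs del: append_Nil2)
next
  case (Succ x)
  then show ?case
    using true_inD[of I "[]" "Run Succ 1" "[Reg 0 1, Reg 0 0]" "vec [x]"]
    by (simp add: inst_def)
next
  case (Proj i xs)
  then show ?case
    using true_inD[of I "[]" "Run (Proj i) (length xs)" "Reg i 0 # regs 0 (length xs)" "vec (xs @ [])"]
    by (simp add: inst_def tval_regs del: append_Nil2)
next
  case (Comp xs gs zs f y)
  let ?n = "length xs" and ?m = "length gs" and ?a = "vec (xs @ zs @ [y])"
  have m: "length zs = ?m"
    using Comp.IH(1) by (auto dest: list_all2_lengthD)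
  have sat: "satisfies I (clauses f ?m)" "\<And>g. g \<in> set gs \<Longrightarrow> satisfies I (clauses g ?n)"
    and rule: "true_in I ((Run f ?m, Reg (?n + ?m) 0 # regs ?n ?m)
         # map (\<lambda>i. (Run (gs ! i) ?n, Reg (?n + i) 0 # regs 0 ?n)) [0..<?m],
       Run (Comp f gs) ?n, Reg (?n + ?m) 0 # regs 0 ?n)"
    using Comp.prems by (auto simp: Let_def)
  have xs: "map ?a [0..<?n] = xs" and zs: "map ?a [?n..<?n + ?m] = zs"
    and y: "?a (?n + ?m) = y"
    using map_vec_middle[of xs zs "[y]"] m by simp_all
  have "I (Run f ?m) (vec (y # zs))"
    using Comp.IH(2) sat(1) by (simp add: m)
  moreover have "I (Run (gs ! i) ?n) (vec (zs ! i # xs))" if "i < ?m" for i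
    using Comp.IH(1) that sat(2)[of "gs ! i"] by (auto simp: list_all2_conv_all_nth)
  ultimately have "I (Run (Comp f gs) ?n) (inst ?a (Reg (?n + ?m) 0 # regs 0 ?n))"
    by (intro true_inD[OF rule])
       (auto simp: inst_def tval_regs xs zs y m simp del: vec_append, simp add: m)
  then show ?case by (simp add: inst_def tval_regs xs y del: vec_append)
next
  case (PrimRec_0 f xs y g)
  let ?k = "length xs" and ?a = "vec (xs @ [y])"
  have sat: "satisfies I (clauses f ?k)"
    and rule: "true_in I ([(Run f ?k, Reg ?k 0 # regs 0 ?k)],
      Run (PrimRec f g) (Suc ?k), Reg ?k 0 # Num 0 # regs 0 ?k)"
    using PrimRec_0.prems by simp_all
  from true_inD[OF rule, of ?a] PrimRec_0.IH sat show ?case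
    by (simp add: inst_def tval_regs)
next
  case (PrimRec_Suc f g n xs y z)
  let ?k = "length xs" and ?a = "vec (xs @ [n, y, z])"
  have sat: "satisfies I (clauses g (Suc (Suc ?k)))"
    and rule: "true_in I ([(Run (PrimRec f g) (Suc ?k), Reg (?k + 1) 0 # Reg ?k 0 # regs 0 ?k),
        (Run g (Suc (Suc ?k)), Reg (?k + 2) 0 # Reg ?k 0 # Reg (?k + 1) 0 # regs 0 ?k)],
       Run (PrimRec f g) (Suc ?k), Reg (?k + 2) 0 # Reg ?k 1 # regs 0 ?k)"
    using PrimRec_Suc.prems by simp_all
  have "I (Run (PrimRec f g) (Suc ?k)) (vec (y # n # xs))"
    using PrimRec_Suc.IH(1) PrimRec_Suc.prems by simp
  moreover have "I (Run g (Suc (Suc ?k))) (vec (z # n # y # xs))"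
    using PrimRec_Suc.IH(2) sat by simp
  ultimately have "I (Run (PrimRec f g) (Suc ?k)) (inst ?a (Reg (?k + 2) 0 # Reg ?k 1 # regs 0 ?k))"
    by (intro true_inD[OF rule]) (auto simp: inst_def tval_regs numeral_2_eq_2)
  then show ?case by (simp add: inst_def tval_regs numeral_2_eq_2)
next
  case (Mu f n xs)
  let ?k = "length xs"
  have sat: "satisfies I (clauses f (Suc ?k))"
    and rule0: "true_in I ([], Below f ?k, Num 0 # regs 0 ?k)"
    and rule1: "true_in I ([(Below f ?k, Reg ?k 0 # regs 0 ?k),
        (Run f (Suc ?k), Reg (?k + 1) 1 # Reg ?k 0 # regs 0 ?k)],
       Below f ?k, Reg ?k 1 # regs 0 ?k)"
    and rule2: "true_in I ([(Below f ?k, Reg ?k 0 # regs 0 ?k),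
        (Run f (Suc ?k), Num 0 # Reg ?k 0 # regs 0 ?k)],
       Run (Mu f) ?k, Reg ?k 0 # regs 0 ?k)"
    using Mu.prems by simp_all
  have below: "I (Below f ?k) (vec (i # xs))" if "i \<le> n" for i
    using that
  proof (induction i)
    case 0
    from true_inD[OF rule0, of "vec (xs @ [])"] show ?case
      by (simp add: inst_def tval_regs del: append_Nil2)
  next
    case (Suc i)
    then have "i < n" by simp
    with Mu.IH(2) obtain y where "satisfies I (clauses f (length (i # xs)))
        \<longrightarrow> I (Run f (length (i # xs))) (vec (Suc y # i # xs))"
      by blast
    then have "I (Run f (Suc ?k)) (vec (Suc y # i # xs))"
      using sat by simp
    with Suc have "I (Below f ?k) (inst (vec (xs @ [i, y])) (Reg ?k 1 # regs 0 ?k))"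
      by (intro true_inD[OF rule1]) (auto simp: inst_def tval_regs)
    then show ?case by (simp add: inst_def tval_regs)
  qed
  have "I (Run f (Suc ?k)) (vec (0 # n # xs))"
    using Mu.IH(1) sat by simp
  with below[of n] have "I (Run (Mu f) ?k) (inst (vec (xs @ [n])) (Reg ?k 0 # regs 0 ?k))"
    by (intro true_inD[OF rule2]) (auto simp: inst_def tval_regs)
  then show ?case by (simp add: inst_def tval_regs)
qed

text \<open>The interpretation by true computations. \<open>Goal\<close> is read relative to a set \<open>G\<close> of inputs on
  which the result \<open>1\<close> is admitted.\<close>

fun standard :: "(nat \<Rightarrow> bool) \<Rightarrow> pred \<Rightarrow> (nat \<Rightarrow> nat) \<Rightarrow> bool" where
  "standard G (Run f n) a \<longleftrightarrow> computes f (map a [1..<Suc n]) (a 0)"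
| "standard G (Below f n) a \<longleftrightarrow> (\<forall>i < a 0. \<exists>y. computes f (i # map a [1..<Suc n]) (Suc y))"
| "standard G Goal a \<longleftrightarrow> (a 0 = 1 \<longrightarrow> G (a 1))"

lemma map_inst_Cons: "map (inst a (t # ts)) [1..<Suc (length ts)] = map (tval a) ts"
  by (rule nth_equalityI) (simp_all add: inst_def vec_def del: upt_Suc)

lemma inst_Cons_0: "inst a (t # ts) 0 = tval a t"
  by (simp add: inst_def vec_def)

lemma standard_Run_inst:
  "length ts = n \<Longrightarrow> standard G (Run f n) (inst a (t # ts)) \<longleftrightarrow> computes f (map (tval a) ts) (tval a t)"
  using map_inst_Cons[of a t ts] by (simp add: inst_Cons_0 del: upt_Suc)

lemma standard_Below_inst:
  "length ts = n \<Longrightarrow> standard G (Below f n) (inst a (t # ts)) \<longleftrightarrow>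
    (\<forall>i < tval a t. \<exists>y. computes f (i # map (tval a) ts) (Suc y))"
  using map_inst_Cons[of a t ts] by (simp add: inst_Cons_0 del: upt_Suc)

declare standard.simps(1,2) [simp del]

text \<open>Read under this interpretation, every clause is a valid inference about \<open>computes\<close>.\<close>

lemma standard_satisfies_clauses: "satisfies (standard G) (clauses f n)"
proof (induction f n rule: clauses.induct)
  case (1 n)
  show ?case
    by (auto intro!: true_inI computes.intros simp: standard_Run_inst)
next
  case (2 n)
  show ?case
    by (auto intro!: true_inI computes.intros simp: standard_Run_inst)
next
  case (3 i n)
  have "computes (Proj i) (map a [0..<n]) (a i)" if "i < n" for a
    using computes.Proj[of i "map a [0..<n]"] that by simp
  then show ?case
    by (auto intro!: true_inI simp: standard_Run_inst tval_regs)
next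
  case (4 f gs n)
  let ?m = "length gs"
  have "true_in (standard G) ((Run f ?m, Reg (n + ?m) 0 # regs n ?m)
         # map (\<lambda>i. (Run (gs ! i) n, Reg (n + i) 0 # regs 0 n)) [0..<?m],
       Run (Comp f gs) n, Reg (n + ?m) 0 # regs 0 n)" (is "true_in _ (?ps, _)")
  proof (rule true_inI)
    fix a
    assume *: "\<forall>p \<in> set ?ps. standard G (fst p) (inst a (snd p))"
    then have "computes f (map a [n..<n + ?m]) (a (n + ?m))"
      by (simp add: standard_Run_inst tval_regs)
    moreover have "computes (gs ! i) (map a [0..<n]) (a (n + i))" if "i < ?m" for i
      using * that by (simp add: standard_Run_inst tval_regs)
    ultimately have "computes (Comp f gs) (map a [0..<n]) (a (n + ?m))"
      by (intro computes.Comp[where zs = "map a [n..<n + ?m]"]) (auto simp: list_all2_conv_all_nth)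
    then show "standard G (Run (Comp f gs) n) (inst a (Reg (n + ?m) 0 # regs 0 n))"
      by (simp add: standard_Run_inst tval_regs)
  qed
  with 4 show ?case by (simp add: Let_def Ball_def) blast
next
  case (5 f g n)
  show ?case
  proof (cases n)
    case (Suc k)
    have "true_in (standard G) ([(Run f k, Reg k 0 # regs 0 k)],
      Run (PrimRec f g) n, Reg k 0 # Num 0 # regs 0 k)"
      by (rule true_inI)
        (simp add: Suc standard_Run_inst tval_regs computes.PrimRec_0)
    moreover have "true_in (standard G) ([(Run (PrimRec f g) n, Reg (k + 1) 0 # Reg k 0 # regs 0 k),
        (Run g (Suc n), Reg (k + 2) 0 # Reg k 0 # Reg (k + 1) 0 # regs 0 k)],
       Run (PrimRec f g) n, Reg (k + 2) 0 # Reg k 1 # regs 0 k)"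
      by (rule true_inI)
        (auto simp: Suc standard_Run_inst tval_regs intro: computes.PrimRec_Suc)
    ultimately show ?thesis using 5 Suc by (auto simp: ball_Un)
  qed simp
next
  case (6 f n)
  have "true_in (standard G) ([], Below f n, Num 0 # regs 0 n)"
    by (rule true_inI) (simp add: standard_Below_inst)
  moreover have "true_in (standard G) ([(Below f n, Reg n 0 # regs 0 n),
        (Run f (Suc n), Reg (n + 1) 1 # Reg n 0 # regs 0 n)],
       Below f n, Reg n 1 # regs 0 n)"
    by (rule true_inI)
      (auto simp: standard_Below_inst standard_Run_inst tval_regs less_Suc_eq)
  moreover have "true_in (standard G) ([(Below f n, Reg n 0 # regs 0 n),
        (Run f (Suc n), Num 0 # Reg n 0 # regs 0 n)],
       Run (Mu f) n, Reg n 0 # regs 0 n)"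
    by (rule true_inI)
      (auto simp: standard_Below_inst standard_Run_inst tval_regs intro!: computes.Mu)
  ultimately show ?case using 6 by (auto simp: ball_Un)
qed

definition program :: "recf \<Rightarrow> clause list" where
  "program f = ([(Run f 1, regs 0 2)], Goal, regs 0 2) # clauses f 1"

lemma computes_iff_program_forces_Goal:
  "computes f [n] 1 \<longleftrightarrow> (\<forall>I. satisfies I (program f) \<longrightarrow> I Goal (vec [1, n]))"
proof
  assume *: "computes f [n] 1"
  have r: "inst (vec [1, n]) (regs 0 2) = vec [1, n]"
    by (simp add: inst_def tval_regs numeral_2_eq_2)
  show "\<forall>I. satisfies I (program f) \<longrightarrow> I Goal (vec [1, n])"
  proof (intro allI impI)
    fix I
    assume I: "satisfies I (program f)"
    then have "I (Run f 1) (vec [1, n])"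
      using computes_forces[OF *, of I] by (simp add: program_def)
    moreover have "true_in I ([(Run f 1, regs 0 2)], Goal, regs 0 2)"
      using I by (simp add: program_def)
    ultimately show "I Goal (vec [1, n])"
      using true_inD[of I "[(Run f 1, regs 0 2)]" Goal "regs 0 2" "vec [1, n]"]
      by (simp add: r[simplified])
  qed
next
  assume *: "\<forall>I. satisfies I (program f) \<longrightarrow> I Goal (vec [1, n])"
  let ?I = "standard (\<lambda>n. computes f [n] 1)"
  have r: "regs 0 2 = Reg 0 0 # [Reg 1 0]"
    by (simp add: regs_def numeral_2_eq_2)
  have "true_in ?I ([(Run f 1, regs 0 2)], Goal, regs 0 2)"
    unfolding r
    by (rule true_inI) (auto simp: standard.simps(1) inst_def)
  then have "?I Goal (vec [1, n])"
    using *[rule_format, of ?I] standard_satisfies_clauses by (auto simp: program_def)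
  then show "computes f [n] 1" by simp
qed

section \<open>Formulas that axiomatise a Horn program\<close>

text \<open>The unary functions on tuples that the relation has to encode. The value of \<open>\<sigma>\<close> at \<open>x\<close> is
  reached from \<open>x\<close> in two steps of the relation, through an edge state labelled \<open>Arrow \<sigma>\<close>. The
  label \<open>Point\<close> separates tuples from edges and from the spy.\<close>

datatype symbol = Inc nat | Subst "tm list"

datatype mark = Point | Arrow symbol | Atom pred

instance tm :: countable by countable_datatype
instance symbol :: countable by countable_datatype
instance recf :: countable by countable_datatype
instance pred :: countable by countable_datatype
instance mark :: countable by countable_datatype

definition lvar :: "mark \<Rightarrow> form" where "lvar m = Var (L (to_nat m))"
definition rvar :: "mark \<Rightarrow> form" where "rvar m = Var (R (to_nat m))"

definition Imp :: "form \<Rightarrow> form \<Rightarrow> form" where "Imp \<phi> \<psi> = Neg (Conj \<phi> (Neg \<psi>))"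
definition Dia :: "form \<Rightarrow> form" where "Dia \<phi> = Neg (Box (Neg \<phi>))"
definition BlackDia :: "form \<Rightarrow> form" where "BlackDia \<phi> = Neg (BlackBox (Neg \<phi>))"

primrec Conjs :: "form list \<Rightarrow> form" where
  "Conjs [] = Imp Same Same"
| "Conjs (\<phi> # \<phi>s) = Conj \<phi> (Conjs \<phi>s)"

definition BothDia :: "form \<Rightarrow> form" where "BothDia \<phi> = Dia (BlackDia (Conj Same \<phi>))"

definition lstep :: "symbol \<Rightarrow> form \<Rightarrow> form" where
  "lstep \<sigma> \<phi> = Box (Imp (lvar (Arrow \<sigma>)) (Box \<phi>))"
definition rstep :: "symbol \<Rightarrow> form \<Rightarrow> form" where
  "rstep \<sigma> \<phi> = BlackBox (Imp (rvar (Arrow \<sigma>)) (BlackBox \<phi>))"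

definition lpath :: "symbol list \<Rightarrow> form \<Rightarrow> form" where "lpath = foldr lstep"
definition rpath :: "symbol list \<Rightarrow> form \<Rightarrow> form" where "rpath = foldr rstep"

text \<open>Read at a diagonal pair, this is the law that the composites \<open>u\<close> and \<open>v\<close> agree at one state.
  Universal modalities suffice, because the existence of arrows is imposed separately.\<close>

definition path_eq :: "symbol list \<Rightarrow> symbol list \<Rightarrow> form" where
  "path_eq u v = lpath u (rpath v Same)"

text \<open>Moving both coordinates together makes sure that the same edge carries the left and the
  right label; otherwise left and right steps might follow different edges.\<close>

definition has_arrow :: "symbol \<Rightarrow> form" where
  "has_arrow \<sigma> = BothDia (Conj (lvar (Arrow \<sigma>)) (Conj (rvar (Arrow \<sigma>)) (BothDia (lvar Point))))"

text \<open>A clause with assignment \<open>a\<close> becomes a statement about the state of the tuple \<open>a\<close>: each atom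
  is a label of the state that one substitution step leads to.\<close>

fun clause_form :: "clause \<Rightarrow> form" where
  "clause_form (ps, Q, us) =
    Imp (Conjs (map (\<lambda>(P, ts). Dia (Conj (lvar (Arrow (Subst ts))) (Dia (lvar (Atom P))))) ps))
      (lstep (Subst us) (lvar (Atom Q)))"

definition tuples :: "clause list \<Rightarrow> tm list list" where
  "tuples \<Gamma> = concat (map (\<lambda>(ps, c). map snd (c # ps)) \<Gamma>)"

lemma tuples_clause:
  assumes "(ps, Q, us) \<in> set \<Gamma>"
  shows "insert us (snd ` set ps) \<subseteq> set (tuples \<Gamma>)"
  using assms by (induction \<Gamma>) (auto simp: tuples_def)

text \<open>Incrementing variable \<open>j\<close> increments exactly these components of the tuple denoted by
  \<open>ts\<close>.\<close>

definition occurrences :: "nat \<Rightarrow> tm list \<Rightarrow> nat list" where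
  "occurrences j ts = filter (\<lambda>i. \<exists>c. ts ! i = Reg j c) [0..<length ts]"

text \<open>Increments, in a fixed order, that lead from the zero tuple to the first \<open>K\<close> components of
  \<open>a\<close>.\<close>

definition word :: "nat \<Rightarrow> (nat \<Rightarrow> nat) \<Rightarrow> nat list" where
  "word K a = concat (map (\<lambda>i. replicate (a i) i) [0..<K])"

definition symbols :: "nat \<Rightarrow> clause list \<Rightarrow> symbol list" where
  "symbols K \<Gamma> = map Inc [0..<K] @ map Subst (tuples \<Gamma>)"

text \<open>The laws at one tuple: the functions are defined, increments commute with each other and
  pass through substitutions, and the clauses of the program hold.\<close>

definition point_form :: "nat \<Rightarrow> clause list \<Rightarrow> form" where
  "point_form K \<Gamma> = Conjs (
     map has_arrow (symbols K \<Gamma>)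
     @ [path_eq [Inc i, Inc j] [Inc j, Inc i]. i \<leftarrow> [0..<K], j \<leftarrow> [0..<K]]
     @ [path_eq [Inc j, Subst ts] (Subst ts # map Inc (occurrences j ts)). j \<leftarrow> [0..<K], ts \<leftarrow> tuples \<Gamma>]
     @ map clause_form \<Gamma>)"

text \<open>The origin is the zero tuple: substituting it into \<open>ts\<close> leaves the constants of \<open>ts\<close>, which
  increments reach from the origin.\<close>

definition origin_form :: "nat \<Rightarrow> clause list \<Rightarrow> form" where
  "origin_form K \<Gamma> = Conjs (Same # lvar Point #
     [path_eq [Subst ts] (map Inc (word K (inst (\<lambda>_. 0) ts))). ts \<leftarrow> tuples \<Gamma>])"

text \<open>At \<open>(w, w)\<close>: the successors of \<open>w\<close> are closed under the relation, so that \<open>w\<close> sees directly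
  whatever its successors can reach; and \<open>\<phi>\<close> holds on the diagonal at all tuples among them.\<close>

definition spy_form :: "form \<Rightarrow> form" where
  "spy_form \<phi> = Conj (Box (Box (BlackDia Same)))
     (Box (BlackBox (Imp Same (Imp (lvar Point) \<phi>))))"

text \<open>To be evaluated at \<open>(x, x)\<close> for the origin \<open>x\<close>. The right coordinate moves to a spy, which
  must see \<open>x\<close>; then the left one follows, because \<open>spy_form\<close> speaks about a diagonal pair.\<close>

definition axioms_form :: "nat \<Rightarrow> clause list \<Rightarrow> form" where
  "axioms_form K \<Gamma> = Conj (origin_form K \<Gamma>)
     (BlackDia (Conj (BlackDia Same) (Dia (Conj Same (spy_form (point_form K \<Gamma>))))))"

text \<open>The increments lead from the origin to the tuple \<open>(1, n)\<close>. Starting at the origin rather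
  than at the spy makes \<open>query (Suc n)\<close> a single step around \<open>query n\<close>, so that its code is
  primitive recursive in \<open>n\<close>.\<close>

definition query :: "nat \<Rightarrow> form" where
  "query n = lpath (replicate n (Inc 1) @ [Inc 0]) (Neg (lvar (Atom Goal)))"

section \<open>Truth conditions of the axioms\<close>

definition bears :: "'w model \<Rightarrow> mark \<Rightarrow> 'w \<Rightarrow> bool" where
  "bears M m x \<longleftrightarrow> x \<in> val M (L (to_nat m))"

definition arrow :: "'w model \<Rightarrow> symbol \<Rightarrow> 'w \<Rightarrow> 'w \<Rightarrow> bool" where
  "arrow M \<sigma> x y \<longleftrightarrow> (\<exists>e. (x, e) \<in> rel M \<and> e \<in> val M (L (to_nat (Arrow \<sigma>)))
     \<and> e \<in> val M (R (to_nat (Arrow \<sigma>))) \<and> (e, y) \<in> rel M)"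

lemma holds_derived [simp]:
  "holds M s t (lvar m) \<longleftrightarrow> bears M m s"
  "holds M s t (rvar m) \<longleftrightarrow> t \<in> val M (R (to_nat m))"
  "holds M s t (Imp \<phi> \<psi>) \<longleftrightarrow> (holds M s t \<phi> \<longrightarrow> holds M s t \<psi>)"
  "holds M s t (Dia \<phi>) \<longleftrightarrow> (\<exists>s'. (s, s') \<in> rel M \<and> holds M s' t \<phi>)"
  "holds M s t (BlackDia \<phi>) \<longleftrightarrow> (\<exists>t'. (t, t') \<in> rel M \<and> holds M s t' \<phi>)"
  "holds M s s (BothDia \<phi>) \<longleftrightarrow> (\<exists>s'. (s, s') \<in> rel M \<and> holds M s' s' \<phi>)"
  by (auto simp: lvar_def rvar_def bears_def Imp_def Dia_def BlackDia_def BothDia_def)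

lemma holds_Conjs [simp]: "holds M s t (Conjs \<phi>s) \<longleftrightarrow> (\<forall>\<phi> \<in> set \<phi>s. holds M s t \<phi>)"
  by (induction \<phi>s) auto

lemma path_simps [simp]:
  "lpath [] \<phi> = \<phi>" "lpath (\<sigma> # u) \<phi> = lstep \<sigma> (lpath u \<phi>)"
  "rpath [] \<phi> = \<phi>" "rpath (\<sigma> # u) \<phi> = rstep \<sigma> (rpath u \<phi>)"
  by (simp_all add: lpath_def rpath_def)

lemma holds_lstep:
  "holds M x t (lstep \<sigma> \<phi>) \<longleftrightarrow>
    (\<forall>e y. (x, e) \<in> rel M \<longrightarrow> bears M (Arrow \<sigma>) e \<longrightarrow> (e, y) \<in> rel M \<longrightarrow> holds M y t \<phi>)"
  by (auto simp: lstep_def)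

lemma holds_rstep:
  "holds M s x (rstep \<sigma> \<phi>) \<longleftrightarrow>
    (\<forall>e y. (x, e) \<in> rel M \<longrightarrow> e \<in> val M (R (to_nat (Arrow \<sigma>))) \<longrightarrow> (e, y) \<in> rel M \<longrightarrow> holds M s y \<phi>)"
  by (auto simp: rstep_def)

lemma holds_lstepD: "holds M x t (lstep \<sigma> \<phi>) \<Longrightarrow> arrow M \<sigma> x y \<Longrightarrow> holds M y t \<phi>"
  by (auto simp: holds_lstep arrow_def bears_def)

lemma holds_rstepD: "holds M s x (rstep \<sigma> \<phi>) \<Longrightarrow> arrow M \<sigma> x y \<Longrightarrow> holds M s y \<phi>"
  by (auto simp: holds_rstep arrow_def)

lemma holds_has_arrow: "holds M x x (has_arrow \<sigma>) \<longleftrightarrow> (\<exists>y. arrow M \<sigma> x y \<and> bears M Point y)"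
  by (auto simp: has_arrow_def arrow_def bears_def)

lemma holds_clause_form:
  "holds M x t (clause_form (ps, Q, us)) \<longleftrightarrow>
    ((\<forall>p \<in> set ps. \<exists>e y. (x, e) \<in> rel M \<and> bears M (Arrow (Subst (snd p))) e
        \<and> (e, y) \<in> rel M \<and> bears M (Atom (fst p)) y)
      \<longrightarrow> holds M x t (lstep (Subst us) (lvar (Atom Q))))"
  by (simp add: split_beta)

lemma holds_point_form:
  "holds M x x (point_form K \<Gamma>) \<longleftrightarrow>
    (\<forall>\<sigma> \<in> set (symbols K \<Gamma>). \<exists>y. arrow M \<sigma> x y \<and> bears M Point y)
    \<and> (\<forall>i < K. \<forall>j < K. holds M x x (path_eq [Inc i, Inc j] [Inc j, Inc i]))
    \<and> (\<forall>j < K. \<forall>ts \<in> set (tuples \<Gamma>).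
          holds M x x (path_eq [Inc j, Subst ts] (Subst ts # map Inc (occurrences j ts))))
    \<and> (\<forall>c \<in> set \<Gamma>. holds M x x (clause_form c))"
  unfolding point_form_def holds_Conjs holds_has_arrow[symmetric]
  by (simp add: ball_Un atLeast0LessThan lessThan_def del: holds_derived)

declare clause_form.simps [simp del]

lemma holds_spy_form:
  "holds M w w (spy_form \<phi>) \<longleftrightarrow>
    (\<forall>y z. (w, y) \<in> rel M \<longrightarrow> (y, z) \<in> rel M \<longrightarrow> (w, z) \<in> rel M)
    \<and> (\<forall>y. (w, y) \<in> rel M \<longrightarrow> bears M Point y \<longrightarrow> holds M y y \<phi>)"
  by (auto simp: spy_form_def)

lemma holds_axioms_form:
  "holds M x t (axioms_form K \<Gamma>) \<longleftrightarrow> t = x \<and> bears M Point x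
     \<and> (\<forall>ts \<in> set (tuples \<Gamma>). holds M x x (path_eq [Subst ts] (map Inc (word K (inst (\<lambda>_. 0) ts)))))
     \<and> (\<exists>w. (x, w) \<in> rel M \<and> (w, x) \<in> rel M
          \<and> (\<forall>y z. (w, y) \<in> rel M \<longrightarrow> (y, z) \<in> rel M \<longrightarrow> (w, z) \<in> rel M)
          \<and> (\<forall>y. (w, y) \<in> rel M \<longrightarrow> bears M Point y \<longrightarrow> holds M y y (point_form K \<Gamma>)))"
  unfolding holds_spy_form[symmetric] axioms_form_def origin_form_def by auto

lemma count_list_replicate: "count_list (replicate n x) y = (if x = y then n else 0)"
  by (induction n) auto

lemma count_list_word: "count_list (word K a) i = (if i < K then a i else 0)"
  by (induction K) (auto simp: word_def count_list_append count_list_replicate)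

lemma count_list_occurrences:
  "count_list (occurrences j ts) i = (if i < length ts \<and> (\<exists>c. ts ! i = Reg j c) then 1 else 0)"
proof -
  have "count_list (filter P [0..<m]) i = (if i < m \<and> P i then 1 else 0)" for P m
    by (induction m) (auto simp: count_list_append less_Suc_eq)
  then show ?thesis by (simp add: occurrences_def)
qed

lemma word_cong: "(\<And>i. i < K \<Longrightarrow> a i = b i) \<Longrightarrow> word K a = word K b"
  by (auto simp: word_def intro!: arg_cong[of _ _ concat])

lemma set_word: "set (word K a) \<subseteq> {..<K}"
  by (auto simp: word_def)

lemma inst_upd_Suc:
  "inst (a(j := Suc (a j))) ts i = inst a ts i + count_list (occurrences j ts) i"
  by (cases "ts ! i") (auto simp: inst_def vec_def count_list_occurrences)

text \<open>Only components below \<open>K\<close> have increments; this is enough for programs all of whose term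
  lists fit.\<close>

definition fits :: "nat \<Rightarrow> tm list \<Rightarrow> bool" where
  "fits K ts \<longleftrightarrow> length ts \<le> K \<and> (\<forall>j c. Reg j c \<in> set ts \<longrightarrow> j < K)"

lemma fits_cong: "fits K ts \<Longrightarrow> (\<And>i. i < K \<Longrightarrow> a i = b i) \<Longrightarrow> inst a ts = inst b ts"
proof -
  assume *: "fits K ts" "\<And>i. i < K \<Longrightarrow> a i = b i"
  have "tval a t = tval b t" if "t \<in> set ts" for t
    using that * by - (cases t; auto simp: fits_def)
  then show ?thesis by (simp add: inst_def cong: map_cong)
qed

lemma ex_fits: "\<exists>K\<ge>2. \<forall>ts \<in> set tss. fits K ts"
proof -
  have single: "\<exists>K. fits K ts" for ts
  proof -
    have "\<exists>K. \<forall>j c. Reg j c \<in> set ts \<longrightarrow> j < K"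
    proof (induction ts)
      case (Cons t ts)
      then obtain K where K: "\<forall>j c. Reg j c \<in> set ts \<longrightarrow> j < K" by blast
      show ?case
      proof (cases t)
        case (Reg j c)
        then show ?thesis using K by (intro exI[of _ "max K (Suc j)"]) (auto simp: less_max_iff_disj)
      qed (use K in auto)
    qed simp
    then obtain K where "\<forall>j c. Reg j c \<in> set ts \<longrightarrow> j < K" by blast
    then have "fits (max K (length ts)) ts" by (auto simp: fits_def less_max_iff_disj)
    then show ?thesis by blast
  qed
  have mono: "fits K ts \<Longrightarrow> K \<le> K' \<Longrightarrow> fits K' ts" for K K' ts
    by (force simp: fits_def)
  show ?thesis
  proof (induction tss)
    case (Cons ts tss)
    from Cons obtain K where K: "K \<ge> 2" "\<forall>ts \<in> set tss. fits K ts" by blast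
    from single obtain K' where "fits K' ts" by blast
    with K show ?case
      by (intro exI[of _ "max K K'"]) (auto intro: mono)
  qed auto
qed

section \<open>Interpretations from models\<close>

text \<open>Choice turns the arrows of the model into functions \<open>F \<sigma>\<close> on the tuples that the spy sees.
  By the path equations the increments commute, so a state reached from the origin by increments
  depends only on how often each of them is used. This gives a state \<open>pt a\<close> for each tuple \<open>a\<close>,
  and an induction on increment words shows that the function for \<open>ts\<close> maps \<open>pt a\<close> to
  \<open>pt (inst a ts)\<close>. Since the formula of each clause holds at \<open>pt a\<close>, the labels of the states
  \<open>pt a\<close> satisfy the program.\<close>

lemma satisfying_interpretation:
  assumes axioms: "holds M x0 t (axioms_form K \<Gamma>)" and query: "holds M x0 t (query n)"
    and K: "K \<ge> 2" "\<forall>ts \<in> set (tuples \<Gamma>). fits K ts"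
  obtains I where "satisfies I \<Gamma>" "\<not> I Goal (vec [1, n])"
proof -
  from axioms obtain w where t: "t = x0" and w: "(w, x0) \<in> rel M"
    and trans: "\<And>y z. (w, y) \<in> rel M \<Longrightarrow> (y, z) \<in> rel M \<Longrightarrow> (w, z) \<in> rel M"
    and x0: "bears M Point x0"
    and origin: "\<And>ts. ts \<in> set (tuples \<Gamma>) \<Longrightarrow>
      holds M x0 x0 (path_eq [Subst ts] (map Inc (word K (inst (\<lambda>_. 0) ts))))"
    and point: "\<And>y. (w, y) \<in> rel M \<Longrightarrow> bears M Point y \<Longrightarrow> holds M y y (point_form K \<Gamma>)"
    unfolding holds_axioms_form by blast
  define A where "A = {x. (w, x) \<in> rel M \<and> bears M Point x}"
  have x0A: "x0 \<in> A"
    using w x0 by (simp add: A_def)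
  have pointA: "holds M x x (point_form K \<Gamma>)" if "x \<in> A" for x
    using that point by (simp add: A_def)
  \<comment> \<open>The identity outside \<open>A\<close> makes the increments commute globally.\<close>
  define F where "F \<sigma> x = (if x \<in> A then SOME y. arrow M \<sigma> x y \<and> bears M Point y else x)" for \<sigma> x
  have F: "arrow M \<sigma> x (F \<sigma> x) \<and> F \<sigma> x \<in> A" if x: "x \<in> A" and \<sigma>: "\<sigma> \<in> set (symbols K \<Gamma>)" for \<sigma> x
  proof -
    have "\<exists>y. arrow M \<sigma> x y \<and> bears M Point y"
      using pointA[OF x] \<sigma> by (simp add: holds_point_form)
    then have "arrow M \<sigma> x (F \<sigma> x) \<and> bears M Point (F \<sigma> x)"
      using x by (simp add: F_def) (rule someI_ex)
    moreover from this have "(w, F \<sigma> x) \<in> rel M"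
      using x trans by (auto simp: A_def arrow_def)
    ultimately show ?thesis by (simp add: A_def)
  qed
  have FA: "fold F u x \<in> A" if "x \<in> A" "set u \<subseteq> set (symbols K \<Gamma>)" for u x
    using that by (induction u arbitrary: x) (auto simp: F)
  have F_out: "fold F u x = x" if "x \<notin> A" for u x
    using that by (induction u) (auto simp: F_def)
  have lpath: "holds M (fold F u x) y \<phi>"
    if "holds M x y (lpath u \<phi>)" "x \<in> A" "set u \<subseteq> set (symbols K \<Gamma>)" for u x y \<phi>
    using that by (induction u arbitrary: x) (auto dest: holds_lstepD[OF _ F[THEN conjunct1]] simp: F)
  have rpath: "holds M y (fold F u x) \<phi>"
    if "holds M y x (rpath u \<phi>)" "x \<in> A" "set u \<subseteq> set (symbols K \<Gamma>)" for u x y \<phi>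
    using that by (induction u arbitrary: x) (auto dest: holds_rstepD[OF _ F[THEN conjunct1]] simp: F)
  have path_eq: "fold F u x = fold F v x"
    if "holds M x x (path_eq u v)" "x \<in> A" "set u \<subseteq> set (symbols K \<Gamma>)" "set v \<subseteq> set (symbols K \<Gamma>)"
    for u v x
    using rpath[OF lpath[OF that(1)[unfolded path_eq_def] that(2,3)] that(2,4)] by simp
  have sym_Inc: "Inc j \<in> set (symbols K \<Gamma>) \<longleftrightarrow> j < K" for j
    by (auto simp: symbols_def)
  have sym_Incs: "set (map Inc u) \<subseteq> set (symbols K \<Gamma>)" if "set u \<subseteq> {..<K}" for u
    using that by (auto simp: sym_Inc)
  have sym_Subst: "Subst ts \<in> set (symbols K \<Gamma>)" if "ts \<in> set (tuples \<Gamma>)" for ts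
    using that by (simp add: symbols_def)
  define S where "S j = F (Inc j)" for j
  have fold_S: "fold F (map Inc u) x = fold S u x" for u x
    by (simp add: fold_map comp_def S_def[abs_def])
  have fold_S_A: "fold S u x \<in> A" if "x \<in> A" "set u \<subseteq> {..<K}" for u x
    using FA[OF that(1) sym_Incs[OF that(2)]] by (simp only: fold_S)
  have commute: "S i (S j x) = S j (S i x)" if "i < K" "j < K" for i j x
  proof (cases "x \<in> A")
    case True
    have "holds M x x (path_eq [Inc j, Inc i] [Inc i, Inc j])"
      using pointA[OF True] that by (simp add: holds_point_form)
    from path_eq[OF this True] that show ?thesis by (simp add: sym_Inc S_def)
  qed (simp add: S_def F_def)
  define pt where "pt a = fold S (word K a) x0" for a
  have fold_pt: "fold S u x0 = pt (count_list u)" if "set u \<subseteq> {..<K}" for u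
  proof -
    have "mset u = mset (word K (count_list u))"
      using that by (intro multiset_eqI) (auto simp: count_mset count_list_word count_list_0_iff)
    then have "fold S u = fold S (word K (count_list u))"
      using that commute by (intro fold_multiset_equiv) (auto simp: fun_eq_iff subset_iff)
    then show ?thesis by (simp add: pt_def)
  qed
  have pt_cong: "pt a = pt b" if "\<And>i. i < K \<Longrightarrow> a i = b i" for a b
    using word_cong[OF that] by (simp add: pt_def)
  have occ: "set (occurrences j ts) \<subseteq> {..<K}" if "ts \<in> set (tuples \<Gamma>)" for j ts
    using K(2) that by (auto simp: occurrences_def fits_def)
  have F_Subst_fold: "F (Subst ts) (fold S u x0) = pt (inst (count_list u) ts)"
    if u: "set u \<subseteq> {..<K}" and ts: "ts \<in> set (tuples \<Gamma>)" for u ts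
    using u
  proof (induction u rule: rev_induct)
    case Nil
    from path_eq[OF origin[OF ts] x0A _ sym_Incs[OF set_word]] sym_Subst[OF ts]
    show ?case by (simp add: fold_S pt_def cong: word_cong)
  next
    case (snoc j u)
    let ?x = "fold S u x0" and ?b = "inst (count_list u) ts"
    have x: "?x \<in> A"
      using snoc.prems by (simp add: fold_S_A x0A)
    have "holds M ?x ?x (path_eq [Inc j, Subst ts] (Subst ts # map Inc (occurrences j ts)))"
      using pointA[OF x] snoc.prems ts by (simp add: holds_point_form)
    from path_eq[OF this x] have "F (Subst ts) (S j ?x) = fold S (occurrences j ts) (F (Subst ts) ?x)"
      using sym_Subst[OF ts] sym_Incs[OF occ[OF ts, of j]] snoc.prems
      by (simp add: fold_S sym_Inc S_def)
    also have "\<dots> = fold S (word K ?b @ occurrences j ts) x0"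
      using snoc by (simp add: pt_def)
    also have "\<dots> = pt (count_list (word K ?b @ occurrences j ts))"
      using set_word occ[OF ts, of j] by (intro fold_pt) auto
    also have "\<dots> = pt (inst ((count_list u)(j := Suc (count_list u j))) ts)"
      by (rule pt_cong) (simp add: inst_upd_Suc count_list_append count_list_word)
    also have "(count_list u)(j := Suc (count_list u j)) = count_list (u @ [j])"
      by (auto simp: count_list_append)
    finally show ?case by simp
  qed
  have F_Subst: "F (Subst ts) (pt a) = pt (inst a ts)" if ts: "ts \<in> set (tuples \<Gamma>)" for ts a
  proof -
    have "inst (count_list (word K a)) ts = inst a ts"
      using K(2) ts by (intro fits_cong[of K]) (auto simp: count_list_word)
    then show ?thesis
      using F_Subst_fold[OF set_word ts] by (simp add: pt_def)
  qed
  have ptA: "pt a \<in> A" for a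
    by (simp add: pt_def fold_S_A x0A set_word)
  define I where "I P a = bears M (Atom P) (pt a)" for P a
  have "true_in I (ps, Q, us)" if c: "(ps, Q, us) \<in> set \<Gamma>" for ps Q us
  proof (rule true_inI)
    fix a
    assume prems: "\<forall>p \<in> set ps. I (fst p) (inst a (snd p))"
    have tup: "us \<in> set (tuples \<Gamma>)" "\<And>P ts. (P, ts) \<in> set ps \<Longrightarrow> ts \<in> set (tuples \<Gamma>)"
      using tuples_clause[OF c] by force+
    have cl: "holds M (pt a) (pt a) (clause_form (ps, Q, us))"
      using pointA[OF ptA] c by (simp add: holds_point_form)
    have "\<exists>e y. (pt a, e) \<in> rel M \<and> bears M (Arrow (Subst ts)) e
        \<and> (e, y) \<in> rel M \<and> bears M (Atom P) y" if "(P, ts) \<in> set ps" for P ts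
    proof -
      have "arrow M (Subst ts) (pt a) (pt (inst a ts))"
        using F[OF ptA sym_Subst] tup(2)[OF that] F_Subst by metis
      moreover have "bears M (Atom P) (pt (inst a ts))"
        using prems that by (auto simp: I_def)
      ultimately show ?thesis by (auto simp: arrow_def bears_def)
    qed
    with cl have "holds M (pt a) (pt a) (lstep (Subst us) (lvar (Atom Q)))"
      by (auto simp: holds_clause_form)
    from holds_lstepD[OF this] F[OF ptA sym_Subst[OF tup(1)], of a] show "I Q (inst a us)"
      by (simp add: F_Subst[OF tup(1)] I_def)
  qed
  then have "satisfies I \<Gamma>" by auto
  moreover have "\<not> I Goal (vec [1, n])"
  proof -
    let ?u = "replicate n 1 @ [0::nat]"
    have u: "set ?u \<subseteq> {..<K}"
      using K(1) by auto
    have "count_list ?u i = vec [1, n] i" for i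
      by (auto simp: count_list_append count_list_replicate vec_def nth_Cons')
    then have "fold S ?u x0 = pt (vec [1, n])"
      using fold_pt[OF u] pt_cong[of "count_list ?u" "vec [1, n]"] by simp
    moreover have "holds M (fold F (map Inc ?u) x0) t (Neg (lvar (Atom Goal)))"
      using query u by (intro lpath x0A) (auto simp: query_def sym_Inc)
    ultimately show ?thesis by (simp only: fold_S) (simp add: I_def)
  qed
  ultimately show thesis by (rule that)
qed

section \<open>The model of tuples\<close>

text \<open>An edge state records the tuple it leaves and the function that it applies.\<close>

datatype state = Spy | Tuple "nat \<Rightarrow> nat" | Edge "nat \<Rightarrow> nat" symbol

primrec act :: "symbol \<Rightarrow> (nat \<Rightarrow> nat) \<Rightarrow> nat \<Rightarrow> nat" where
  "act (Inc j) a = a(j := Suc (a j))"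
| "act (Subst ts) a = inst a ts"

fun marked :: "(pred \<Rightarrow> (nat \<Rightarrow> nat) \<Rightarrow> bool) \<Rightarrow> state \<Rightarrow> mark \<Rightarrow> bool" where
  "marked I (Tuple a) Point \<longleftrightarrow> True"
| "marked I (Tuple a) (Atom P) \<longleftrightarrow> I P a"
| "marked I (Edge a \<sigma>) (Arrow \<tau>) \<longleftrightarrow> \<sigma> = \<tau>"
| "marked I _ _ \<longleftrightarrow> False"

fun edge :: "state \<Rightarrow> state \<Rightarrow> bool" where
  "edge Spy y \<longleftrightarrow> True"
| "edge (Tuple a) y \<longleftrightarrow> y = Spy \<or> (\<exists>\<sigma>. y = Edge a \<sigma>)"
| "edge (Edge a \<sigma>) y \<longleftrightarrow> y = Tuple (act \<sigma> a)"

text \<open>Left and right variables of the same index get the same extension, so that left and right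
  steps follow the same arrows.\<close>

definition tuple_model :: "(pred \<Rightarrow> (nat \<Rightarrow> nat) \<Rightarrow> bool) \<Rightarrow> state model" where
  "tuple_model I = \<lparr>states = UNIV, rel = {(x, y). edge x y},
     val = (\<lambda>p. {x. \<exists>m. (p = L (to_nat m) \<or> p = R (to_nat m)) \<and> marked I x m})\<rparr>"

lemma rel_tuple_model [simp]: "(x, y) \<in> rel (tuple_model I) \<longleftrightarrow> edge x y"
  by (simp add: tuple_model_def)

lemma val_tuple_model [simp]:
  "bears (tuple_model I) m x \<longleftrightarrow> marked I x m"
  "x \<in> val (tuple_model I) (R (to_nat m)) \<longleftrightarrow> marked I x m"
  by (auto simp: tuple_model_def bears_def)

lemma marked_iff [simp]:
  "marked I x Point \<longleftrightarrow> (\<exists>a. x = Tuple a)"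
  "marked I x (Arrow \<sigma>) \<longleftrightarrow> (\<exists>a. x = Edge a \<sigma>)"
  by (cases x; auto)+

lemma holds_path_tuple_model:
  "holds (tuple_model I) (Tuple a) t (lpath u \<phi>) \<longleftrightarrow> holds (tuple_model I) (Tuple (fold act u a)) t \<phi>"
  "holds (tuple_model I) s (Tuple a) (rpath u \<phi>) \<longleftrightarrow> holds (tuple_model I) s (Tuple (fold act u a)) \<phi>"
  by (induction u arbitrary: a) (auto simp: holds_lstep holds_rstep)

lemma holds_path_eq_tuple_model:
  "holds (tuple_model I) (Tuple a) (Tuple a) (path_eq u v) \<longleftrightarrow> fold act u a = fold act v a"
  by (simp add: path_eq_def holds_path_tuple_model)

lemma fold_act_Inc: "fold act (map Inc u) a = (\<lambda>i. a i + count_list u i)"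
  by (induction u arbitrary: a) auto

text \<open>The tuple denoted by \<open>ts\<close> vanishes from component \<open>K\<close> on, so increments below \<open>K\<close> reach it
  exactly.\<close>

lemma inst_as_word:
  assumes "fits K ts"
  shows "inst a ts = (\<lambda>i. count_list (word K (inst a ts)) i)"
  using assms by (auto simp: fun_eq_iff count_list_word inst_def vec_def fits_def)

lemma arrow_tuple_model: "arrow (tuple_model I) \<sigma> (Tuple a) y \<longleftrightarrow> y = Tuple (act \<sigma> a)"
  by (auto simp: arrow_def simp flip: bears_def)

lemma holds_clause_tuple_model:
  assumes "true_in I c"
  shows "holds (tuple_model I) (Tuple a) t (clause_form c)"
proof -
  obtain ps Q us where c: "c = (ps, Q, us)" by (cases c) auto
  show ?thesis
    using true_inD[OF assms[unfolded c], of a]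
    by (fastforce simp: c holds_clause_form holds_lstep)
qed

lemma holds_axioms_form_tuple_model:
  assumes "satisfies I \<Gamma>" and "\<forall>ts \<in> set (tuples \<Gamma>). fits K ts"
  shows "holds (tuple_model I) (Tuple (\<lambda>_. 0)) (Tuple (\<lambda>_. 0)) (axioms_form K \<Gamma>)"
proof -
  have "holds (tuple_model I) (Tuple a) (Tuple a) (point_form K \<Gamma>)" for a
    using assms(1)
    by (simp add: holds_point_form arrow_tuple_model holds_path_eq_tuple_model
        holds_clause_tuple_model fold_act_Inc inst_upd_Suc) (auto simp: fun_eq_iff inst_upd_Suc)
  moreover have "inst (\<lambda>_. 0) ts = fold act (map Inc (word K (inst (\<lambda>_. 0) ts))) (\<lambda>_. 0)"
    if "ts \<in> set (tuples \<Gamma>)" for ts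
    using inst_as_word[of K ts "\<lambda>_. 0"] assms(2) that by (simp add: fold_act_Inc)
  ultimately show ?thesis
    unfolding holds_axioms_form by (auto simp: holds_path_eq_tuple_model intro!: exI[of _ Spy])
qed

lemma holds_query_tuple_model:
  "holds (tuple_model I) (Tuple (\<lambda>_. 0)) t (query n) \<longleftrightarrow> \<not> I Goal (vec [1, n])"
proof -
  have "fold act (map Inc (replicate n 1 @ [0])) (\<lambda>_. 0) = vec [1, n]"
    unfolding fold_act_Inc
    by (auto simp: fun_eq_iff count_list_append count_list_replicate vec_def nth_Cons')
  then show ?thesis by (simp add: query_def holds_path_tuple_model)
qed

text \<open>The tuple model has its own type of states; \<open>satisfiable_transfer\<close> moves it to \<open>'w\<close>.\<close>

theorem satisfiable_iff_interpretation:
  assumes inf: "infinite (UNIV :: 'w set)"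
    and K: "K \<ge> 2" "\<forall>ts \<in> set (tuples \<Gamma>). fits K ts"
  shows "satisfiable TYPE('w) (Conj (query n) (axioms_form K \<Gamma>)) \<longleftrightarrow>
    (\<exists>I. satisfies I \<Gamma> \<and> \<not> I Goal (vec [1, n]))"
proof
  assume "satisfiable TYPE('w) (Conj (query n) (axioms_form K \<Gamma>))"
  then obtain M :: "'w model" and s t where "holds M s t (axioms_form K \<Gamma>)" "holds M s t (query n)"
    by (auto simp: satisfiable_def)
  then show "\<exists>I. satisfies I \<Gamma> \<and> \<not> I Goal (vec [1, n])"
    using K by (rule satisfying_interpretation) blast
next
  assume "\<exists>I. satisfies I \<Gamma> \<and> \<not> I Goal (vec [1, n])"
  then obtain I where I: "satisfies I \<Gamma>" "\<not> I Goal (vec [1, n])" by blast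
  have "is_model (tuple_model I)"
    by (simp add: is_model_def tuple_model_def)
  moreover have "states (tuple_model I) = UNIV"
    by (simp add: tuple_model_def)
  ultimately have "satisfiable TYPE(state) (Conj (query n) (axioms_form K \<Gamma>))"
    unfolding satisfiable_def
    using holds_axioms_form_tuple_model[OF I(1) K(2)] I(2)
    by (intro exI[of _ "tuple_model I"] exI[of _ "Tuple (\<lambda>_. 0)"]) (simp add: holds_query_tuple_model)
  then show "satisfiable TYPE('w) (Conj (query n) (axioms_form K \<Gamma>))"
    using inf by (rule satisfiable_transfer)
qed

section \<open>Computing codes of formulas\<close>

text \<open>A program is only required to be correct on argument lists of the intended length \<open>k\<close>.\<close>

definition recursive :: "nat \<Rightarrow> (nat list \<Rightarrow> nat) \<Rightarrow> bool" where
  "recursive k h \<longleftrightarrow> (\<exists>r. \<forall>xs. length xs = k \<longrightarrow> computes r xs (h xs))"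

lemma recursive_nth: "i < k \<Longrightarrow> recursive k (\<lambda>xs. xs ! i)"
  unfolding recursive_def by (auto intro!: exI[of _ "Proj i"] computes.Proj)

lemma recursive_unary: "recursive 1 h \<Longrightarrow> \<exists>r. \<forall>n. computes r [n] (h [n])"
  unfolding recursive_def by (metis length_Cons list.size(3) One_nat_def)

lemma recursive_comp:
  assumes "recursive (length gs) h" and "\<And>g. g \<in> set gs \<Longrightarrow> recursive k g"
  shows "recursive k (\<lambda>xs. h (map (\<lambda>g. g xs) gs))"
proof -
  from assms(2) obtain r where "\<forall>g \<in> set gs. \<forall>xs. length xs = k \<longrightarrow> computes (r g) xs (g xs)"
    unfolding recursive_def by metis
  moreover from assms(1) obtain q where "\<forall>xs. length xs = length gs \<longrightarrow> computes q xs (h xs)"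
    unfolding recursive_def by blast
  ultimately have "computes (Comp q (map r gs)) xs (h (map (\<lambda>g. g xs) gs))" if "length xs = k" for xs
    using that by (intro computes.Comp[where zs = "map (\<lambda>g. g xs) gs"])
      (auto simp: list_all2_conv_all_nth)
  then show ?thesis unfolding recursive_def by blast
qed

lemma recursive_Suc:
  assumes "recursive k h"
  shows "recursive k (\<lambda>xs. Suc (h xs))"
proof -
  have "recursive 1 (\<lambda>xs. Suc (xs ! 0))"
    unfolding recursive_def
    by (rule exI[of _ Succ]) (auto simp: length_Suc_conv intro: computes.Succ)
  from recursive_comp[of "[h]", simplified, OF this[simplified]] assms show ?thesis by simp
qed

lemma recursive_const: "recursive k (\<lambda>_. c)"
proof (induction c)
  case 0
  show ?case unfolding recursive_def by (auto intro!: exI[of _ Zero] computes.Zero)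
qed (rule recursive_Suc)

lemma recursive_rec_nat:
  assumes "recursive k h" and "recursive (Suc (Suc k)) step"
  shows "recursive (Suc k) (\<lambda>xs. rec_nat (h (tl xs)) (\<lambda>n y. step (n # y # tl xs)) (hd xs))"
proof -
  from assms obtain q r where
    q: "\<And>xs. length xs = k \<Longrightarrow> computes q xs (h xs)" and
    r: "\<And>xs. length xs = Suc (Suc k) \<Longrightarrow> computes r xs (step xs)"
    unfolding recursive_def by blast
  have "computes (PrimRec q r) (n # xs) (rec_nat (h xs) (\<lambda>n y. step (n # y # xs)) n)"
    if "length xs = k" for n xs
    by (induction n) (auto intro!: computes.PrimRec_0 q computes.PrimRec_Suc r simp: that)
  then have "computes (PrimRec q r) xs (rec_nat (h (tl xs)) (\<lambda>n y. step (n # y # tl xs)) (hd xs))"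
    if "length xs = Suc k" for xs
    using that by (cases xs) auto
  then show ?thesis unfolding recursive_def by blast
qed

lemma recursive_add:
  assumes "recursive k g" "recursive k h"
  shows "recursive k (\<lambda>xs. g xs + h xs)"
proof -
  have rec: "rec_nat x (\<lambda>_. Suc) n = n + x" for n x :: nat
    by (induction n) auto
  have "recursive (length [g, h])
      (\<lambda>xs. rec_nat (tl xs ! 0) (\<lambda>n y. Suc ((n # y # tl xs) ! 1)) (hd xs))"
    using recursive_rec_nat[OF recursive_nth[of 0 "Suc 0"]
        recursive_Suc[OF recursive_nth[of 1 "Suc (Suc (Suc 0))"]]]
    by (simp add: eval_nat_numeral)
  from recursive_comp[OF this, of k] assms show ?thesis by (auto simp: rec)
qed

lemma recursive_triangle:
  assumes "recursive k h"
  shows "recursive k (\<lambda>xs. triangle (h xs))"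
proof -
  have rec: "rec_nat 0 (\<lambda>n y. y + Suc n) n = triangle n" for n
    by (induction n) auto
  have "recursive (length [h])
      (\<lambda>xs. rec_nat 0 (\<lambda>n y. (n # y # tl xs) ! 1 + Suc ((n # y # tl xs) ! 0)) (hd xs))"
    using recursive_rec_nat[OF recursive_const[of 0 0]
        recursive_add[OF recursive_nth[of 1 "Suc (Suc 0)"]
          recursive_Suc[OF recursive_nth[of 0 "Suc (Suc 0)"]]]]
    by (simp add: eval_nat_numeral)
  from recursive_comp[OF this, of k] assms show ?thesis by (auto simp: rec[simplified])
qed

lemma recursive_prod_encode:
  "recursive k g \<Longrightarrow> recursive k h \<Longrightarrow> recursive k (\<lambda>xs. prod_encode (g xs, h xs))"
  unfolding prod_encode_def by (simp add: recursive_add recursive_triangle)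

lemmas recursive_intros = recursive_prod_encode recursive_const

lemma query_Suc: "query (Suc n) = lstep (Inc 1) (query n)"
  by (simp add: query_def)

text \<open>The effect on codes of prefixing an increment of component 1, which is the step of the
  recursion for \<open>code (query n)\<close>.\<close>

definition code_lstep :: "nat \<Rightarrow> nat" where
  "code_lstep c = prod_encode (4, prod_encode (2, prod_encode (3,
     prod_encode (code (lvar (Arrow (Inc 1))), prod_encode (2, prod_encode (4, c))))))"

lemma recursive_code_query: "recursive 1 (\<lambda>xs. code (query (xs ! 0)))"
proof -
  have "recursive (Suc (Suc 0)) (\<lambda>xs. code_lstep (xs ! 1))"
    unfolding code_lstep_def by (intro recursive_intros recursive_nth) simp
  from recursive_rec_nat[OF recursive_const this]
  have "recursive 1 (\<lambda>xs. rec_nat (code (query 0)) (\<lambda>_. code_lstep) (hd xs))"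
    by simp
  moreover have "rec_nat (code (query 0)) (\<lambda>_. code_lstep) n = code (query n)" for n
    by (induction n) (auto simp: query_Suc code_lstep_def lstep_def Imp_def)
  ultimately have "recursive 1 (\<lambda>xs. code (query (hd xs)))" by simp
  then show ?thesis
    unfolding recursive_def by (metis hd_conv_nth length_0_conv one_neq_zero)
qed

text \<open>When \<open>\<psi>\<close> is the axiomatisation of \<open>d\<close>, the formula \<open>Conj (query (code \<psi>)) \<psi>\<close> is satisfiable
  iff \<open>d\<close> does not return \<open>1\<close> on \<open>code \<psi>\<close>; but on that input \<open>d\<close> decides the satisfiability of
  this very formula.\<close>

theorem theorem1:
  assumes "infinite (UNIV :: 'w set)"
  shows "\<not> decidable (satisfiable TYPE('w))"
proof
  assume "decidable (satisfiable TYPE('w))"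
  then obtain f where
    f: "\<And>\<phi>. computes f [code \<phi>] (if satisfiable TYPE('w) \<phi> then 1 else 0)"
    by (auto simp: decidable_def)
  \<comment> \<open>\<open>h\<close> is to map the code of \<open>\<psi>\<close> to the code of \<open>Conj (query (code \<psi>)) \<psi>\<close>.\<close>
  have "recursive 1 (\<lambda>xs. prod_encode (3, prod_encode (code (query (xs ! 0)), xs ! 0)))"
    by (intro recursive_intros recursive_code_query recursive_nth) simp
  from recursive_unary[OF this] obtain h where
    h: "\<And>n. computes h [n] (prod_encode (3, prod_encode (code (query n), n)))"
    by auto
  define d where "d = Comp f [h]"
  obtain K where K: "K \<ge> 2" "\<forall>ts \<in> set (tuples (program d)). fits K ts"
    using ex_fits by blast
  define \<psi> where "\<psi> = axioms_form K (program d)"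
  define \<phi> where "\<phi> = Conj (query (code \<psi>)) \<psi>"
  have "computes h [code \<psi>] (code \<phi>)"
    using h[of "code \<psi>"] by (simp add: \<phi>_def)
  then have d: "computes d [code \<psi>] (if satisfiable TYPE('w) \<phi> then 1 else 0)"
    unfolding d_def using f[of \<phi>] by (intro computes.Comp[where zs = "[code \<phi>]"]) auto
  have "satisfiable TYPE('w) \<phi> \<longleftrightarrow> \<not> computes d [code \<psi>] 1"
    unfolding \<phi>_def \<psi>_def satisfiable_iff_interpretation[OF assms K] computes_iff_program_forces_Goal
    by blast
  then show False
    using d computes_deterministic[OF d, of 1] by (auto split: if_splits)
qed

end
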